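(* For a p-point $\mathcal{U}$ on $\omega$ the following are equivalent: (1) $\mathcal{U}\ge_T\omega^\omega$; (2) $\mathcal{U}\equiv_T\prod_{n<\omega}\mathcal{U}$; (3) $\mathcal{U}\equiv_T\mathcal{U}\cdot\mathcal{U}$.
   Context: Ultrafilters are ordered by $\supseteq$, $\omega^\omega$ by pointwise $\le$, and $\prod_{n<\omega}\mathcal{U}$ (product of $\omega$ copies of $\mathcal{U}$) by the coordinatewise order. $D\le_T E$ means there is a map $E\to D$ sending cofinal subsets to cofinal subsets; $\equiv_T$ means both directions. $\mathcal{U}\cdot\mathcal{U}=\{A\subseteq\omega\times\omega:\{i:\{j:(i,j)\in A\}\in\mathcal{U}\}\in\mathcal{U}\}$. A p-point is a nonprincipal ultrafilter on $\omega$ in which every countable subfamily $\{X_n\}$ has some $X$ in the ultrafilter with $X\setminus X_n$ finite for all $n$. *)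

theory Defs
  imports Complex_Main
begin

section \<open>Ultrafilters and p-points\<close>

definition ultrafilter :: "'a filter \<Rightarrow> bool" where
  "ultrafilter F \<longleftrightarrow>
     F \<noteq> bot \<and> (\<forall>P. eventually P F \<or> eventually (\<lambda>x. \<not> P x) F)"

text \<open>The family of sets belonging to a filter.\<close>

definition filter_sets :: "'a filter \<Rightarrow> 'a set set" where
  "filter_sets F = {A. \<forall>\<^sub>F x in F. x \<in> A}"

definition p_point :: "nat filter \<Rightarrow> bool" where
  "p_point U \<longleftrightarrow>
     ultrafilter U \<and> (\<forall>x. U \<noteq> principal {x}) \<and>
     (\<forall>X :: nat \<Rightarrow> nat set. (\<forall>n. X n \<in> filter_sets U) \<longrightarrow>
        (\<exists>Y \<in> filter_sets U. \<forall>n. finite (Y - X n)))"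

text \<open>
  The Fubini product, a filter on pairs; it differs from the library's \<open>U \<times>\<^sub>F V\<close>, which is
  generated by rectangles. See \<open>filter_sets_fubini\<close> below for its members.
\<close>

definition fubini_product :: "'a filter \<Rightarrow> 'b filter \<Rightarrow> ('a \<times> 'b) filter" where
  "fubini_product U V = Abs_filter (\<lambda>P. \<forall>\<^sub>F i in U. \<forall>\<^sub>F j in V. P (i, j))"

lemma eventually_fubini:
  "eventually P (fubini_product U V) \<longleftrightarrow> (\<forall>\<^sub>F i in U. \<forall>\<^sub>F j in V. P (i, j))"
  unfolding fubini_product_def
proof (rule eventually_Abs_filter, rule is_filter.intro)
  fix P Q :: "'a \<times> 'b \<Rightarrow> bool"
  show "\<forall>\<^sub>F i in U. \<forall>\<^sub>F j in V. P (i, j) \<and> Q (i, j)"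
    if "\<forall>\<^sub>F i in U. \<forall>\<^sub>F j in V. P (i, j)" "\<forall>\<^sub>F i in U. \<forall>\<^sub>F j in V. Q (i, j)"
    using that by eventually_elim (rule eventually_conj)
  show "\<forall>\<^sub>F i in U. \<forall>\<^sub>F j in V. Q (i, j)"
    if "\<forall>x. P x \<longrightarrow> Q x" "\<forall>\<^sub>F i in U. \<forall>\<^sub>F j in V. P (i, j)"
    using that(2) by eventually_elim (use that(1) in \<open>auto elim: eventually_mono\<close>)
qed simp

lemma filter_sets_fubini:
  "filter_sets (fubini_product U V) =
     {A. {i. {j. (i, j) \<in> A} \<in> filter_sets V} \<in> filter_sets U}"
  by (simp add: filter_sets_def eventually_fubini)

lemma ultrafilter_fubini:
  assumes "ultrafilter U" "ultrafilter V"
  shows "ultrafilter (fubini_product U V)"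
proof -
  have neg: "(\<forall>\<^sub>F x in F. \<not> P x) \<longleftrightarrow> \<not> eventually P F" if "ultrafilter F"
    for F :: "'c filter" and P
  proof
    assume *: "\<forall>\<^sub>F x in F. \<not> P x"
    show "\<not> eventually P F"
    proof
      assume "eventually P F"
      with * have "\<forall>\<^sub>F x in F. False"
        by eventually_elim simp
      with that show False
        by (simp add: ultrafilter_def eventually_False)
    qed
  qed (use that in \<open>auto simp: ultrafilter_def\<close>)
  have "fubini_product U V \<noteq> bot"
    using assms eventually_fubini[of "\<lambda>_. False" U V]
    by (auto simp: ultrafilter_def eventually_False)
  then show ?thesis
    unfolding ultrafilter_def eventually_fubini by (simp add: neg assms)
qed


section \<open>Tukey reducibility\<close>

text \<open>
  An ordered set is a reflexive relation \<open>r\<close> with underlying set \<open>Field r\<close>, where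
  \<open>(x, y) \<in> r\<close> means that \<open>x\<close> is below \<open>y\<close>. The library's \<open>cofinal\<close> is not used, as it asks for
  elements different from the one to be bounded.
\<close>

definition cofinal_in :: "'a rel \<Rightarrow> 'a set \<Rightarrow> bool" where
  "cofinal_in r C \<longleftrightarrow> C \<subseteq> Field r \<and> (\<forall>x \<in> Field r. \<exists>y \<in> C. (x, y) \<in> r)"

definition tukey_le :: "'a rel \<Rightarrow> 'b rel \<Rightarrow> bool"  (infix "\<le>\<^sub>T" 50) where
  "r \<le>\<^sub>T s \<longleftrightarrow>
     (\<exists>f. f ` Field s \<subseteq> Field r \<and> (\<forall>C. cofinal_in s C \<longrightarrow> cofinal_in r (f ` C)))"

definition tukey_equiv :: "'a rel \<Rightarrow> 'b rel \<Rightarrow> bool"  (infix "\<equiv>\<^sub>T" 50) where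
  "r \<equiv>\<^sub>T s \<longleftrightarrow> r \<le>\<^sub>T s \<and> s \<le>\<^sub>T r"

text \<open>Smaller sets are higher in the order of a filter.\<close>

definition filter_order :: "'a filter \<Rightarrow> 'a set rel" where
  "filter_order F = {(A, B). A \<in> filter_sets F \<and> B \<in> filter_sets F \<and> A \<supseteq> B}"

definition omega_omega :: "(nat \<Rightarrow> nat) rel" where
  "omega_omega = {(f, g). f \<le> g}"

definition omega_power :: "'a rel \<Rightarrow> (nat \<Rightarrow> 'a) rel" where
  "omega_power r = {(f, g). \<forall>n. (f n, g n) \<in> r}"

lemma Field_filter_order: "Field (filter_order F) = filter_sets F"
  by (auto simp: filter_order_def Field_def)

lemma Field_omega_omega: "Field omega_omega = UNIV"
  by (auto simp: omega_omega_def Field_def)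

lemma Field_omega_power:
  fixes r :: "'a rel"
  assumes "refl_on (Field r) r"
  shows "Field (omega_power r) = {f. \<forall>n. f n \<in> Field r}"
proof (intro equalityI subsetI)
  fix f :: "nat \<Rightarrow> 'a" assume "f \<in> {f. \<forall>n. f n \<in> Field r}"
  then have "(f, f) \<in> omega_power r"
    using assms by (auto simp: omega_power_def refl_on_def)
  then show "f \<in> Field (omega_power r)"
    by (rule FieldI1)
qed (auto simp: omega_power_def Field_def)

lemma partial_order_filter_order: "partial_order_on (filter_sets F) (filter_order F)"
  by (auto simp: partial_order_on_def preorder_on_def refl_on_def trans_def antisym_def
      filter_order_def)

lemma Field_omega_power_filter_order:
  "Field (omega_power (filter_order F)) = {f. \<forall>n. f n \<in> filter_sets F}"
  using partial_order_filter_order[of F]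
  by (subst Field_omega_power)
     (simp_all add: partial_order_on_def preorder_on_def Field_filter_order)

end

theory Submission
  imports Defs
begin

text \<open>
  A Tukey reduction amounts to a pair of maps, \<open>g\<close> forward and \<open>f\<close> back, such that \<open>f e\<close> bounds
  \<open>x\<close> whenever \<open>e\<close> bounds \<open>g x\<close>. For every nonprincipal \<open>U\<close>, a sequence \<open>A\<close> in \<open>U\<close> is coded in
  \<open>U \<cdot> U\<close> by the set whose \<open>i\<close>-th section is \<open>A 0 \<inter> \<dots> \<inter> A i\<close>, so \<open>U \<cdot> U\<close> and the power of \<open>U\<close> are
  Tukey equivalent, and \<open>\<omega>\<^sup>\<omega>\<close> lies below the power by taking minima. In a p-point, \<open>A\<close> has a
  pseudointersection \<open>Y\<close>, and a function \<open>h\<close> bounding the finite sets \<open>Y - A n\<close> gives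
  \<open>Y \<inter> {h n..} \<subseteq> A n\<close>; if \<open>U\<close> is above \<open>\<omega>\<^sup>\<omega>\<close>, then \<open>h\<close> is also coded in \<open>U\<close>.
\<close>

section \<open>Tukey reductions as pairs of maps\<close>

lemma tukey_leI:
  assumes "\<And>x. x \<in> Field r \<Longrightarrow> g x \<in> Field s"
    and "\<And>e. e \<in> Field s \<Longrightarrow> f e \<in> Field r"
    and "\<And>x e. x \<in> Field r \<Longrightarrow> e \<in> Field s \<Longrightarrow> (g x, e) \<in> s \<Longrightarrow> (x, f e) \<in> r"
  shows "r \<le>\<^sub>T s"
  unfolding tukey_le_def
proof (intro exI conjI allI impI)
  show "f ` Field s \<subseteq> Field r"
    using assms(2) by blast
  fix C assume C: "cofinal_in s C"
  show "cofinal_in r (f ` C)"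
    unfolding cofinal_in_def
  proof (intro conjI ballI)
    show "f ` C \<subseteq> Field r"
      using C assms(2) by (auto simp: cofinal_in_def)
    fix x assume x: "x \<in> Field r"
    then have "g x \<in> Field s"
      by (rule assms(1))
    then obtain e where "e \<in> C" "(g x, e) \<in> s"
      using C unfolding cofinal_in_def by blast
    moreover from this have "e \<in> Field s"
      by (auto intro: FieldI2)
    ultimately show "\<exists>y \<in> f ` C. (x, y) \<in> r"
      using assms(3) x by blast
  qed
qed

text \<open>If no value of \<open>g x\<close> worked for some \<open>x\<close>, then above every
  \<open>d\<close> there would be an \<open>e\<close> with \<open>f e\<close> not above
  \<open>x\<close>. These \<open>e\<close> would form a cofinal set whose image under
  \<open>f\<close> has nothing above \<open>x\<close>.\<close>

lemma tukey_leE: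
  assumes "r \<le>\<^sub>T s"
  obtains f g where "\<And>x. x \<in> Field r \<Longrightarrow> g x \<in> Field s"
    and "\<And>e. e \<in> Field s \<Longrightarrow> f e \<in> Field r"
    and "\<And>x e. x \<in> Field r \<Longrightarrow> e \<in> Field s \<Longrightarrow> (g x, e) \<in> s \<Longrightarrow> (x, f e) \<in> r"
proof -
  from assms obtain f where f: "f ` Field s \<subseteq> Field r"
    and cof: "\<And>C. cofinal_in s C \<Longrightarrow> cofinal_in r (f ` C)"
    by (auto simp: tukey_le_def)
  have "\<exists>d \<in> Field s. \<forall>e \<in> Field s. (d, e) \<in> s \<longrightarrow> (x, f e) \<in> r" if x: "x \<in> Field r" for x
  proof (rule ccontr)
    assume "\<not> ?thesis"
    then have "cofinal_in s {e \<in> Field s. (x, f e) \<notin> r}"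
      by (auto simp: cofinal_in_def)
    from cof[OF this] x show False
      by (auto simp: cofinal_in_def)
  qed
  then obtain g where
    "\<And>x. x \<in> Field r \<Longrightarrow> g x \<in> Field s \<and> (\<forall>e \<in> Field s. (g x, e) \<in> s \<longrightarrow> (x, f e) \<in> r)"
    by metis
  with f show thesis
    by (intro that[of g f]) auto
qed

lemma tukey_le_trans:
  assumes "r \<le>\<^sub>T s" "s \<le>\<^sub>T t"
  shows "r \<le>\<^sub>T t"
proof -
  obtain f g where 1: "\<And>x. x \<in> Field r \<Longrightarrow> g x \<in> Field s"
    "\<And>e. e \<in> Field s \<Longrightarrow> f e \<in> Field r"
    "\<And>x e. x \<in> Field r \<Longrightarrow> e \<in> Field s \<Longrightarrow> (g x, e) \<in> s \<Longrightarrow> (x, f e) \<in> r"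
    using assms(1) by (rule tukey_leE) blast
  obtain f' g' where 2: "\<And>x. x \<in> Field s \<Longrightarrow> g' x \<in> Field t"
    "\<And>e. e \<in> Field t \<Longrightarrow> f' e \<in> Field s"
    "\<And>x e. x \<in> Field s \<Longrightarrow> e \<in> Field t \<Longrightarrow> (g' x, e) \<in> t \<Longrightarrow> (x, f' e) \<in> s"
    using assms(2) by (rule tukey_leE) blast
  show ?thesis
    by (rule tukey_leI[where g = "\<lambda>x. g' (g x)" and f = "\<lambda>e. f (f' e)"]) (simp_all add: 1 2)
qed

lemma tukey_equiv_sym: "r \<equiv>\<^sub>T s \<Longrightarrow> s \<equiv>\<^sub>T r"
  by (simp add: tukey_equiv_def)

lemma tukey_equiv_trans: "r \<equiv>\<^sub>T s \<Longrightarrow> s \<equiv>\<^sub>T t \<Longrightarrow> r \<equiv>\<^sub>T t"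
  unfolding tukey_equiv_def using tukey_le_trans by metis

section \<open>Nonprincipal ultrafilters contain all tails\<close>

lemma ultrafilter_eq_principal:
  assumes "ultrafilter U" "\<not> eventually (\<lambda>y. y \<noteq> x) U"
  shows "U = principal {x}"
proof -
  have x: "\<forall>\<^sub>F y in U. y = x"
    using assms by (auto simp: ultrafilter_def)
  have "eventually P U \<longleftrightarrow> P x" for P
  proof
    assume "eventually P U"
    with x have "\<forall>\<^sub>F y in U. P x"
      by eventually_elim simp
    then show "P x"
      using assms(1) by (auto simp: ultrafilter_def eventually_const)
  qed (use x in \<open>auto elim: eventually_mono\<close>)
  then show ?thesis
    by (simp add: filter_eq_iff eventually_principal)
qed

text \<open>The complement of each point belongs to \<open>U\<close>, so induction on
  \<open>n\<close> removes the points below \<open>n\<close> one at a time.\<close>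

lemma nonprincipal_le_sequentially:
  assumes "ultrafilter U" "\<And>x. U \<noteq> principal {x}"
  shows "U \<le> sequentially"
proof -
  have "eventually (\<lambda>m. n \<le> m) U" for n
  proof (induction n)
    case (Suc n)
    have "\<forall>\<^sub>F m in U. m \<noteq> n"
      using ultrafilter_eq_principal[OF assms(1)] assms(2)[of n] by metis
    with Suc show ?case
      by eventually_elim simp
  qed simp
  then show ?thesis
    by (simp add: at_top_def le_INF_iff le_principal)
qed

lemma p_point_le_sequentially: "p_point U \<Longrightarrow> U \<le> sequentially"
  by (rule nonprincipal_le_sequentially) (simp_all add: p_point_def)

section \<open>Reductions between \<open>U\<close>, its power and its Fubini square\<close>

lemma filter_order_iff:
  "(A, B) \<in> filter_order F \<longleftrightarrow> A \<in> filter_sets F \<and> B \<in> filter_sets F \<and> B \<subseteq> A"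
  by (simp add: filter_order_def)

lemma omega_omega_iff: "(f, g) \<in> omega_omega \<longleftrightarrow> f \<le> g"
  by (simp add: omega_omega_def)

lemma omega_power_iff: "(f, g) \<in> omega_power r \<longleftrightarrow> (\<forall>n. (f n, g n) \<in> r)"
  by (simp add: omega_power_def)

lemma filter_order_le_omega_power: "filter_order F \<le>\<^sub>T omega_power (filter_order F)"
  by (rule tukey_leI[where g = "\<lambda>A _. A" and f = "\<lambda>A. A 0"])
    (auto simp: Field_filter_order Field_omega_power_filter_order, auto simp: omega_power_iff)

lemma omega_omega_le_omega_power:
  assumes "U \<noteq> bot" "U \<le> sequentially"
  shows "omega_omega \<le>\<^sub>T omega_power (filter_order U)"
proof (rule tukey_leI[where g = "\<lambda>h n. {h n..}" and f = "\<lambda>A n. LEAST m. m \<in> A n"])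
  fix h :: "nat \<Rightarrow> nat"
  have "\<forall>\<^sub>F m in U. h n \<le> m" for n
    using assms(2) by (rule filter_leD) (rule eventually_ge_at_top)
  then show "(\<lambda>n. {h n..}) \<in> Field (omega_power (filter_order U))"
    by (simp add: Field_omega_power_filter_order filter_sets_def)
next
  fix h :: "nat \<Rightarrow> nat" and A
  assume A: "((\<lambda>n. {h n..}), A) \<in> omega_power (filter_order U)"
  have "h n \<le> (LEAST m. m \<in> A n)" for n
  proof -
    from A have "A n \<subseteq> {h n..}" "\<forall>\<^sub>F m in U. m \<in> A n"
      by (auto simp: omega_power_iff filter_order_iff filter_sets_def)
    \<comment> \<open>As \<open>U\<close> is not \<open>bot\<close>, \<open>A n\<close> is nonempty,
      so \<open>LEAST\<close> picks an actual element of it.\<close>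
    moreover from this(2) obtain m where "m \<in> A n"
      using assms(1) eventually_happens by blast
    ultimately show ?thesis
      by (meson LeastI atLeast_iff subsetD)
  qed
  then show "(h, \<lambda>n. LEAST m. m \<in> A n) \<in> omega_omega"
    by (simp add: omega_omega_iff le_fun_def)
qed (simp add: Field_omega_omega)

text \<open>A member of the Fubini square is determined by its sections. Coordinate 0 of the code
  records which sections lie in \<open>U\<close>, and coordinate \<open>Suc i\<close> records the
  \<open>i\<close>-th section.\<close>

lemma fubini_le_omega_power:
  "filter_order (fubini_product U U) \<le>\<^sub>T omega_power (filter_order U)"
  for U :: "nat filter"
proof (rule tukey_leI)
  \<comment> \<open>The default \<open>UNIV\<close> replaces the sections outside \<open>U\<close>,
    so that every coordinate is a member of \<open>U\<close>.\<close>
  let ?g = "\<lambda>A. case_nat {i. {j. (i, j) \<in> A} \<in> filter_sets U}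
    (\<lambda>i. if {j. (i, j) \<in> A} \<in> filter_sets U then {j. (i, j) \<in> A} else UNIV)"
  let ?f = "\<lambda>C. {(i, j). i \<in> C 0 \<and> j \<in> C (Suc i)} :: (nat \<times> nat) set"
  show g: "?g A \<in> Field (omega_power (filter_order U))"
    if "A \<in> Field (filter_order (fubini_product U U))" for A
    using that
    by (auto simp: Field_filter_order Field_omega_power_filter_order filter_sets_fubini
        split: nat.split) (simp add: filter_sets_def)
  show f: "?f C \<in> Field (filter_order (fubini_product U U))"
    if "C \<in> Field (omega_power (filter_order U))" for C
  proof -
    have "\<forall>\<^sub>F i in U. i \<in> C 0" "\<And>i. \<forall>\<^sub>F j in U. j \<in> C (Suc i)"
      using that by (auto simp: Field_omega_power_filter_order filter_sets_def)
    then show ?thesis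
      by (auto simp: Field_filter_order filter_sets_def eventually_fubini eventually_conj_iff
          elim: eventually_mono)
  qed
  show "(A, ?f C) \<in> filter_order (fubini_product U U)"
    if A: "A \<in> Field (filter_order (fubini_product U U))"
      and C: "C \<in> Field (omega_power (filter_order U))"
      and le: "(?g A, C) \<in> omega_power (filter_order U)" for A C
  proof -
    have sub: "C n \<subseteq> ?g A n" for n
      using le by (simp add: omega_power_iff filter_order_iff)
    \<comment> \<open>For a pair \<open>(i, j)\<close> in \<open>?f C\<close>,
      \<open>i \<in> C 0\<close> ensures that the \<open>i\<close>-th section of \<open>A\<close> is
      in \<open>U\<close>. So \<open>?g A (Suc i)\<close> is this section and not the default, and
      it contains \<open>j\<close>.\<close>
    have "?f C \<subseteq> A"
      using sub[of 0] sub[of "Suc i" for i] by (fastforce split: if_splits)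
    then show ?thesis
      using A f[OF C] by (simp add: Field_filter_order filter_order_iff)
  qed
qed

text \<open>Every \<open>Z\<close> in the Fubini square has a section in \<open>U\<close> at some
  index \<open>k Z n \<ge> n\<close>. If \<open>Z\<close> is contained in the code of
  \<open>A\<close>, this section is contained in \<open>A n\<close>, because sections of the code
  from index \<open>n\<close> on are intersections that include \<open>A n\<close>.\<close>

lemma omega_power_le_fubini:
  assumes "U \<noteq> bot" "U \<le> sequentially"
  shows "omega_power (filter_order U) \<le>\<^sub>T filter_order (fubini_product U U)"
proof -
  have "\<exists>i \<ge> n. {j. (i, j) \<in> Z} \<in> filter_sets U"
    if "Z \<in> filter_sets (fubini_product U U)" for Z n
  proof -
    have "\<forall>\<^sub>F i in U. n \<le> i"
      using assms(2) by (rule filter_leD) (rule eventually_ge_at_top)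
    moreover have "\<forall>\<^sub>F i in U. {j. (i, j) \<in> Z} \<in> filter_sets U"
      using that by (simp add: filter_sets_def eventually_fubini)
    ultimately have "\<forall>\<^sub>F i in U. n \<le> i \<and> {j. (i, j) \<in> Z} \<in> filter_sets U"
      by (rule eventually_conj)
    then show ?thesis
      using assms(1) eventually_happens by blast
  qed
  \<comment> \<open>The index is chosen from \<open>Z\<close> and \<open>n\<close> alone, since the
    backward map does not see \<open>A\<close>.\<close>
  then obtain k where k: "\<And>Z n. Z \<in> filter_sets (fubini_product U U) \<Longrightarrow>
      n \<le> k Z n \<and> {j. (k Z n, j) \<in> Z} \<in> filter_sets U"
    by metis
  show ?thesis
  proof (rule tukey_leI[where g = "\<lambda>A. {(i, j). \<forall>n \<le> i. j \<in> A n}"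
        and f = "\<lambda>Z n. {j. (k Z n, j) \<in> Z}"])
    fix A assume "A \<in> Field (omega_power (filter_order U))"
    then have "\<forall>\<^sub>F j in U. \<forall>n \<in> {..i}. j \<in> A n" for i
      by (intro eventually_ball_finite)
        (auto simp: Field_omega_power_filter_order filter_sets_def)
    then show "{(i, j). \<forall>n \<le> i. j \<in> A n} \<in> Field (filter_order (fubini_product U U))"
      by (simp add: Field_filter_order filter_sets_def eventually_fubini Ball_def)
  next
    fix A Z
    assume A: "A \<in> Field (omega_power (filter_order U))"
      and Z: "Z \<in> Field (filter_order (fubini_product U U))"
      and "({(i, j). \<forall>n \<le> i. j \<in> A n}, Z) \<in> filter_order (fubini_product U U)"
    then have "Z \<subseteq> {(i, j). \<forall>n \<le> i. j \<in> A n}"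
      by (simp add: filter_order_iff)
    then have "{j. (k Z n, j) \<in> Z} \<subseteq> A n" for n
      using k[of Z n] Z by (auto simp: Field_filter_order)
    then show "(A, \<lambda>n. {j. (k Z n, j) \<in> Z}) \<in> omega_power (filter_order U)"
      using A Z k
      by (simp add: Field_filter_order Field_omega_power_filter_order omega_power_iff
          filter_order_iff)
  qed (simp add: Field_filter_order Field_omega_power_filter_order k)
qed

text \<open>To recover \<open>A n\<close>, \<open>Y A\<close> has to be cut at \<open>h A n\<close>,
  but the backward map knows only \<open>Z\<close>. It cuts \<open>Z\<close> at \<open>f Z n\<close>
  instead, which is far enough out because \<open>Z \<subseteq> g (h A)\<close> forces
  \<open>h A \<le> f Z\<close>.\<close>

lemma p_point_omega_power_le:
  assumes "p_point U" "omega_omega \<le>\<^sub>T filter_order U"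
  shows "omega_power (filter_order U) \<le>\<^sub>T filter_order U"
proof -
  have tail: "\<forall>\<^sub>F m in U. n \<le> m" for n
    using p_point_le_sequentially[OF assms(1)] by (rule filter_leD) (rule eventually_ge_at_top)
  obtain f g where "\<And>h. h \<in> Field omega_omega \<Longrightarrow> g h \<in> Field (filter_order U)"
    "\<And>h Z. h \<in> Field omega_omega \<Longrightarrow> Z \<in> Field (filter_order U) \<Longrightarrow>
      (g h, Z) \<in> filter_order U \<Longrightarrow> (h, f Z) \<in> omega_omega"
    using assms(2) by (rule tukey_leE) blast
  then have fg: "\<And>h. g h \<in> filter_sets U"
    "\<And>h Z. Z \<in> filter_sets U \<Longrightarrow> (g h, Z) \<in> filter_order U \<Longrightarrow> h \<le> f Z"
    by (simp_all add: Field_filter_order Field_omega_omega omega_omega_iff)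
  have "\<exists>Y h. Y \<in> filter_sets U \<and> (\<forall>n. Y \<inter> {h n..} \<subseteq> A n)"
    if A: "A \<in> Field (omega_power (filter_order U))" for A
  proof -
    obtain Y where Y: "Y \<in> filter_sets U" "\<And>n. finite (Y - A n)"
      using assms(1) A unfolding p_point_def Field_omega_power_filter_order by blast
    \<comment> \<open>The bound is strict, so the tail starting at the bound itself misses
      \<open>Y - A n\<close>.\<close>
    from Y(2) have "\<forall>n. \<exists>b. \<forall>m \<in> Y - A n. m < b"
      by (simp add: finite_nat_set_iff_bounded)
    then obtain h where "\<And>n. \<forall>m \<in> Y - A n. m < h n"
      by metis
    then have "\<forall>n. Y \<inter> {h n..} \<subseteq> A n"
      by (meson DiffI Int_iff atLeast_iff not_less subsetI)
    with Y(1) show ?thesis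
      by blast
  qed
  then obtain Y h where Yh: "\<And>A. A \<in> Field (omega_power (filter_order U)) \<Longrightarrow>
      Y A \<in> filter_sets U \<and> (\<forall>n. Y A \<inter> {h A n..} \<subseteq> A n)"
    by metis
  have Int: "A \<inter> B \<in> filter_sets U" if "A \<in> filter_sets U" "B \<in> filter_sets U" for A B
    using that by (simp add: filter_sets_def eventually_conj_iff)
  have cut: "Z \<inter> {n..} \<in> filter_sets U" if "Z \<in> filter_sets U" for Z n
    using that tail by (intro Int) (simp_all add: filter_sets_def)
  show ?thesis
  proof (rule tukey_leI[where g = "\<lambda>A. Y A \<inter> g (h A)" and f = "\<lambda>Z n. Z \<inter> {f Z n..}"])
    fix A Z
    assume A: "A \<in> Field (omega_power (filter_order U))"
      and Z: "Z \<in> Field (filter_order U)"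
      and "(Y A \<inter> g (h A), Z) \<in> filter_order U"
    then have sub: "Z \<subseteq> Y A" "Z \<subseteq> g (h A)"
      by (auto simp: filter_order_iff)
    from Z sub(2) have "h A \<le> f Z"
      by (intro fg(2)) (auto simp: Field_filter_order filter_order_iff fg(1))
    then have "Z \<inter> {f Z n..} \<subseteq> Y A \<inter> {h A n..}" for n
      using sub(1) by (intro Int_mono) (simp_all add: le_fun_def)
    moreover have "Y A \<inter> {h A n..} \<subseteq> A n" for n
      using Yh[OF A] by blast
    ultimately have "Z \<inter> {f Z n..} \<subseteq> A n" for n
      by (rule order_trans)
    then show "(A, \<lambda>n. Z \<inter> {f Z n..}) \<in> omega_power (filter_order U)"
      using A Z
      by (simp add: Field_filter_order Field_omega_power_filter_order omega_power_iff
          filter_order_iff cut)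
  qed (use Yh in \<open>simp_all add: Field_filter_order Field_omega_power_filter_order Int fg(1) cut\<close>)
qed

theorem theorem35:
  fixes U :: "nat filter"
  assumes "p_point U"
  shows "(omega_omega \<le>\<^sub>T filter_order U \<longleftrightarrow>
            filter_order U \<equiv>\<^sub>T omega_power (filter_order U)) \<and>
         (filter_order U \<equiv>\<^sub>T omega_power (filter_order U) \<longleftrightarrow>
            filter_order U \<equiv>\<^sub>T filter_order (fubini_product U U))"
proof -
  have "U \<noteq> bot"
    using assms by (simp add: p_point_def ultrafilter_def)
  note U = this p_point_le_sequentially[OF assms]
  \<comment> \<open>By transitivity this settles the second equivalence of the theorem; the two
    implications of the first follow.\<close>
  have "omega_power (filter_order U) \<equiv>\<^sub>T filter_order (fubini_product U U)"
    using omega_power_le_fubini[OF U] fubini_le_omega_power by (simp add: tukey_equiv_def)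
  moreover have "omega_omega \<le>\<^sub>T filter_order U"
    if "filter_order U \<equiv>\<^sub>T omega_power (filter_order U)"
    using that omega_omega_le_omega_power[OF U]
    unfolding tukey_equiv_def using tukey_le_trans by metis
  moreover have "filter_order U \<equiv>\<^sub>T omega_power (filter_order U)"
    if "omega_omega \<le>\<^sub>T filter_order U"
    using p_point_omega_power_le[OF assms that] filter_order_le_omega_power
    by (simp add: tukey_equiv_def)
  ultimately show ?thesis
    by (metis tukey_equiv_trans tukey_equiv_sym)
qed

end
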